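(* Let $\alpha,\beta>-1$ and let $N\ge 3$. For $\rho\in\left(0,\frac{\pi}{2N}\right)$ let $H_N^{(\alpha,\beta)}\in\mathbb R^{N\times N}$ be the normalized Jacobi-weighted histopolation matrix on the cells $s_i=[\cos(\tau_i+\rho),\cos(\tau_i-\rho)]$, $\tau_i=\frac{(2i-1)\pi}{2N}$, $i=1,\ldots,N$. Then the following are equivalent: (1) for every $\rho\in\left(0,\frac{\pi}{2N}\right)$, the Gram matrix $\left(H_N^{(\alpha,\beta)}\right)^\top H_N^{(\alpha,\beta)}$ is diagonal; (2) $\alpha=\beta=-\frac12$.
   Context: The Jacobi weight is $\omega_{\alpha,\beta}(x)=(1-x)^\alpha(1+x)^\beta$ on $(-1,1)$. $P_k^{(\alpha,\beta)}$ is the classical Jacobi polynomial of degree $k$ (orthogonal with respect to $\omega_{\alpha,\beta}$, normalized by $P_k^{(\alpha,\beta)}(1)=\frac{(\alpha+1)_k}{k!}$, where $(s)_k$ is the rising factorial). With $m_i^{(\alpha,\beta)}=\int_{s_i}\omega_{\alpha,\beta}(x)\,dx$, the matrix (depending on $\rho$) is defined by $$\left[H_N^{(\alpha,\beta)}\right]_{i,k+1}=\frac{1}{m_i^{(\alpha,\beta)}}\int_{s_i}P_k^{(\alpha,\beta)}(x)\,\omega_{\alpha,\beta}(x)\,dx,\quad i=1,\ldots,N,\ k=0,\ldots,N-1.$$ *)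

theory Defs
  imports
    "HOL-Analysis.Analysis"
    "HOL-Computational_Algebra.Polynomial"
    "Jordan_Normal_Form.Matrix"
begin

definition jacobi_weight :: "real \<Rightarrow> real \<Rightarrow> real \<Rightarrow> real" where
  "jacobi_weight \<alpha> \<beta> x = (1 - x) powr \<alpha> * (1 + x) powr \<beta>"

definition is_jacobi_poly :: "real \<Rightarrow> real \<Rightarrow> nat \<Rightarrow> real poly \<Rightarrow> bool" where
  "is_jacobi_poly \<alpha> \<beta> k p \<longleftrightarrow>
     degree p = k \<and>
     (\<forall>q. degree q < k \<longrightarrow>
        integral {-1<..<1} (\<lambda>x. poly p x * poly q x * jacobi_weight \<alpha> \<beta> x) = 0) \<and>
     poly p 1 = pochhammer (\<alpha> + 1) k / fact k"

text \<open>For \<open>\<alpha>, \<beta> > -1\<close> exactly one polynomial has these properties, so the \<open>THE\<close> below is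
  well defined; see \<open>ex1_jacobi_poly\<close>.\<close>

definition jacobi_poly :: "real \<Rightarrow> real \<Rightarrow> nat \<Rightarrow> real poly" where
  "jacobi_poly \<alpha> \<beta> k = (THE p. is_jacobi_poly \<alpha> \<beta> k p)"

definition cell_angle :: "nat \<Rightarrow> nat \<Rightarrow> real" where
  "cell_angle N i = (2 * real i - 1) * pi / (2 * real N)"

definition cell :: "nat \<Rightarrow> real \<Rightarrow> nat \<Rightarrow> real set" where
  "cell N \<rho> i = {cos (cell_angle N i + \<rho>)..cos (cell_angle N i - \<rho>)}"

definition cell_mass :: "real \<Rightarrow> real \<Rightarrow> nat \<Rightarrow> real \<Rightarrow> nat \<Rightarrow> real" where
  "cell_mass \<alpha> \<beta> N \<rho> i = integral (cell N \<rho> i) (jacobi_weight \<alpha> \<beta>)"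

text \<open>Matrix indices start at \<open>0\<close>, so row \<open>r\<close> belongs to the cell with number \<open>Suc r\<close>, and
  column \<open>k\<close> to the polynomial of degree \<open>k\<close>.\<close>

definition histopolation_matrix :: "real \<Rightarrow> real \<Rightarrow> nat \<Rightarrow> real \<Rightarrow> real mat" where
  "histopolation_matrix \<alpha> \<beta> N \<rho> = mat N N (\<lambda>(r, k).
     1 / cell_mass \<alpha> \<beta> N \<rho> (Suc r) *
     integral (cell N \<rho> (Suc r)) (\<lambda>x. poly (jacobi_poly \<alpha> \<beta> k) x * jacobi_weight \<alpha> \<beta> x))"


lemma jacobi_weight_integrable:
  assumes "\<alpha> > -1" "\<beta> > -1"
  shows "jacobi_weight \<alpha> \<beta> absolutely_integrable_on {-1<..<1}"
proof -
  have 0: "((\<lambda>t. t powr \<beta> * (1 - t) powr \<alpha>) has_integral Beta (\<beta>+1) (\<alpha>+1)) (cbox 0 1)"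
    using has_integral_Beta_real[of "\<beta>+1" "\<alpha>+1"] assms by simp
  have im: "(\<lambda>x::real. (1 / (1/2)) *\<^sub>R x + - ((1 / (1/2)) *\<^sub>R (1/2))) ` cbox 0 1 = {-1..1}"
    using image_affinity_atLeastAtMost[of 2 "-1" 0 "1::real"] by simp
  have "(\<lambda>x. ((1/2) *\<^sub>R x + 1/2) powr \<beta> * (1 - ((1/2) *\<^sub>R x + 1/2)) powr \<alpha>) integrable_on {-1..1}"
    using has_integral_affinity[OF 0, of "1/2" "1/2"] unfolding im integrable_on_def by auto
  from integrable_on_cmult_left[OF this, of "2 powr \<beta> * 2 powr \<alpha>"]
  have "(\<lambda>x. (2 powr \<beta> * 2 powr \<alpha>) * (((1/2) *\<^sub>R x + 1/2) powr \<beta> * (1 - ((1/2) *\<^sub>R x + 1/2)) powr \<alpha>)) integrable_on {-1..1}"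
    by simp
  moreover have "(2 powr \<beta> * 2 powr \<alpha>) * (((1/2) *\<^sub>R x + 1/2) powr \<beta> * (1 - ((1/2) *\<^sub>R x + 1/2)) powr \<alpha>)
      = jacobi_weight \<alpha> \<beta> x" if "x \<in> {-1..1}" for x
  proof -
    have "(2 * (x/2 + 1/2)) powr \<beta> = 2 powr \<beta> * (x/2+1/2) powr \<beta>"
      using that by (intro powr_mult) 
    moreover have "(2 * (1 - (x/2 + 1/2))) powr \<alpha> = 2 powr \<alpha> * (1 - (x/2+1/2)) powr \<alpha>"
      using that by (intro powr_mult)
    moreover have "2 * (x/2 + 1/2) = 1 + x" "2 * (1 - (x/2 + 1/2)) = 1 - x" by auto
    ultimately show ?thesis by (simp add: jacobi_weight_def algebra_simps)
  qed
  ultimately have "jacobi_weight \<alpha> \<beta> integrable_on {-1..1}"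
    using integrable_cong by (smt (verit, best))
  then have "jacobi_weight \<alpha> \<beta> integrable_on {-1<..<1}"
    by (simp add: integrable_on_Icc_iff_Ioo)
  then show ?thesis
    by (intro nonnegative_absolutely_integrable_1) (auto simp: jacobi_weight_def)
qed

lemma poly_jacobi_weight_integrable:
  assumes "\<alpha> > -1" "\<beta> > -1"
  shows "(\<lambda>x. poly p x * jacobi_weight \<alpha> \<beta> x) integrable_on {-1<..<1}"
proof -
  have "bounded (poly p ` {-1..1})"
    by (intro compact_imp_bounded compact_continuous_image continuous_intros) auto
  then have "bounded (poly p ` {-1<..<1})"
    by (rule bounded_subset) auto
  moreover have "poly p \<in> borel_measurable (lebesgue_on {-1<..<1})"
    by (intro continuous_imp_measurable_on_sets_lebesgue continuous_intros) auto
  ultimately have "(\<lambda>x. poly p x * jacobi_weight \<alpha> \<beta> x) absolutely_integrable_on {-1<..<1}"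
    using jacobi_weight_integrable[OF assms]
    by (intro absolutely_integrable_bounded_measurable_product_real) auto
  then show ?thesis
    using set_lebesgue_integral_eq_integral(1) by blast
qed

context
  fixes \<alpha> \<beta> :: real
  assumes \<alpha>: "\<alpha> > -1" and \<beta>: "\<beta> > -1"
begin

private definition J :: "real poly \<Rightarrow> real" where
  "J p = integral {-1<..<1} (\<lambda>x. poly p x * jacobi_weight \<alpha> \<beta> x)"

private lemma J_add: "J (p + q) = J p + J q"
  unfolding J_def using poly_jacobi_weight_integrable[OF \<alpha> \<beta>]
  by (simp add: algebra_simps integral_add)

private lemma J_smult: "J (Polynomial.smult c p) = c * J p"
  by (simp add: J_def mult.assoc)

private lemma J_diff: "J (p - q) = J p - J q"
  using J_add[of p "Polynomial.smult (-1) q"] J_smult[of "-1" q] by simp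

private lemma J_sum: "J (sum f A) = (\<Sum>a\<in>A. J (f a))"
  by (induction A rule: infinite_finite_induct) (auto simp: J_add, auto simp: J_def)

private lemma J_pos:
  assumes "\<And>x. x \<in> {-1<..<1} \<Longrightarrow> poly p x \<ge> 0" "p \<noteq> 0"
  shows "J p > 0"
proof -
  let ?f = "\<lambda>x. poly p x * jacobi_weight \<alpha> \<beta> x"
  let ?I = "{-1/2..1/2::real}"
  have nn: "?f x \<ge> 0" if "x \<in> {-1<..<1}" for x
    using assms(1)[OF that] by (auto simp: jacobi_weight_def)
  have c: "continuous_on ?I ?f"
    unfolding jacobi_weight_def by (intro continuous_intros) auto
  have "integral ?I ?f \<le> J p"
    unfolding J_def using nn poly_jacobi_weight_integrable[OF \<alpha> \<beta>]
    by (intro integral_subset_le integrable_continuous_real[OF c]) auto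
  moreover have "integral ?I ?f \<ge> 0"
    using nn by (intro integral_nonneg integrable_continuous_real[OF c]) auto
  moreover have "integral ?I ?f \<noteq> 0"
  proof
    assume "integral ?I ?f = 0"
    then have "\<forall>x\<in>?I. ?f x = 0"
      using integral_eq_0_iff[OF c] nn by auto
    then have "?I \<subseteq> {x. poly p x = 0}"
      by (auto simp: jacobi_weight_def)
    then have "finite ?I"
      using poly_roots_finite[OF assms(2)] finite_subset by blast
    then show False using infinite_Icc[of "-1/2" "1/2::real"] by simp
  qed
  ultimately show ?thesis by linarith
qed

private lemma is_jacobi_poly_J:
  "is_jacobi_poly \<alpha> \<beta> k p \<longleftrightarrow> degree p = k \<and> (\<forall>q. degree q < k \<longrightarrow> J (p * q) = 0) \<and>
     poly p 1 = pochhammer (\<alpha> + 1) k / fact k"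
  by (simp add: is_jacobi_poly_def J_def)

text \<open>A monic orthogonal polynomial of each degree, by Gram-Schmidt.\<close>

private lemma ex_orthogonal:
  "\<exists>p. degree p = k \<and> lead_coeff p = 1 \<and> (\<forall>q. degree q < k \<longrightarrow> J (p * q) = 0)"
proof (induction k rule: less_induct)
  case (less k)
  then obtain e where deg: "\<And>j. j < k \<Longrightarrow> degree (e j) = j"
    and lc: "\<And>j. j < k \<Longrightarrow> coeff (e j) j = 1"
    and orth: "\<And>j q. j < k \<Longrightarrow> degree q < j \<Longrightarrow> J (e j * q) = 0"
    by metis
  define S where "S = (\<Sum>j<k. Polynomial.smult (J (monom 1 k * e j) / J (e j * e j)) (e j))"
  define p where "p = monom 1 k - S"
  have coeff_S: "coeff S i = 0" if "i \<ge> k" for i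
    unfolding S_def coeff_sum using that deg by (intro sum.neutral) (auto simp: coeff_eq_0)
  have cp: "coeff p k = 1" "coeff p i = 0" if "i > k" for i
    using that coeff_S by (auto simp: p_def)
  have cpk: "coeff p k = 1"
    using coeff_S by (simp add: p_def)
  have dp: "degree p = k"
  proof (rule antisym)
    show "degree p \<le> k" using cp(2) by (intro degree_le) auto
    show "k \<le> degree p" using cpk by (intro le_degree) auto
  qed
  have e0: "J (p * e i) = 0" if i: "i < k" for i
  proof -
    have ne: "J (e i * e i) > 0"
      using lc[OF i] by (intro J_pos) auto
    have "J (S * e i) = (\<Sum>j<k. J (monom 1 k * e j) / J (e j * e j) * J (e j * e i))"
      unfolding S_def by (simp add: sum_distrib_right J_sum J_smult)
    also have "\<dots> = (\<Sum>j<k. if j = i then J (monom 1 k * e i) else 0)"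
    proof (intro sum.cong refl)
      fix j assume j: "j \<in> {..<k}"
      have "J (e j * e i) = 0" if "j \<noteq> i"
      proof (cases "j < i")
        case True
        then have "J (e i * e j) = 0" using orth[OF i] deg j by auto
        then show ?thesis by (simp add: mult.commute)
      next
        case False
        then show ?thesis using orth[of j "e i"] deg i j that by auto
      qed
      then show "J (monom 1 k * e j) / J (e j * e j) * J (e j * e i) =
          (if j = i then J (monom 1 k * e i) else 0)"
        using ne by auto
    qed
    also have "\<dots> = J (monom 1 k * e i)" using i by simp
    finally show ?thesis by (simp add: p_def left_diff_distrib J_diff)
  qed
  have "J (p * q) = 0" if "degree q < k" for q
    using that
  proof (induction "degree q" arbitrary: q rule: less_induct)
    case less
    define r where "r = q - Polynomial.smult (lead_coeff q) (e (degree q))"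
    have split: "J (p * q) = J (p * r) + lead_coeff q * J (p * e (degree q))"
      by (simp add: r_def right_diff_distrib J_diff J_smult)
    show ?case
    proof (cases "r = 0")
      case True
      then show ?thesis using split e0[OF less.prems] by (simp add: J_def)
    next
      case False
      have le: "degree r \<le> degree q"
        unfolding r_def using deg[OF less.prems] by (intro degree_diff_le) auto
      moreover have "coeff r (degree q) = 0"
        using lc[OF less.prems] by (simp add: r_def)
      then have "degree r \<noteq> degree q" using False by (metis leading_coeff_0_iff)
      ultimately have "degree r < degree q" by simp
      then show ?thesis
        using split e0[OF less.prems] less.hyps[of r] less.prems by simp
    qed
  qed
  then show ?case using dp cpk by blast
qed

private lemma orthogonal_at_1:
  assumes "degree p = k" "p \<noteq> 0" "\<And>q. degree q < k \<Longrightarrow> J (p * q) = 0"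
  shows "poly p 1 \<noteq> 0"
proof
  assume "poly p 1 = 0"
  then obtain q where q: "p = [:-1, 1:] * q" by (auto simp: poly_eq_0_iff_dvd)
  have q0: "q \<noteq> 0" using q assms(2) by auto
  then have "degree p = Suc (degree q)" unfolding q by (subst degree_mult_eq) auto
  then have "J (p * q) = 0" using assms by auto
  moreover have "J ([:1, -1:] * q * q) > 0"
  proof (rule J_pos)
    show "poly ([:1, -1:] * q * q) x \<ge> 0" if "x \<in> {-1<..<1}" for x
    proof -
      have "poly ([:1, -1:] * q * q) x = (1 - x) * (poly q x)\<^sup>2"
        by (simp add: power2_eq_square algebra_simps)
      then show ?thesis using that by simp
    qed
    have "[:1, -1:] \<noteq> (0 :: real poly)" by simp
    then show "[:1, -1:] * q * q \<noteq> 0" using q0 by (simp only: mult_eq_0_iff) simp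
  qed
  moreover have "[:1, -1:] * q * q = Polynomial.smult (-1) (p * q)"
    by (simp add: q algebra_simps)
  ultimately show False by (simp only: J_smult)
qed

theorem ex1_jacobi_poly: "\<exists>!p. is_jacobi_poly \<alpha> \<beta> k p"
proof -
  define c where "c = pochhammer (\<alpha> + 1) k / fact k"
  have c: "c \<noteq> 0" unfolding c_def using pochhammer_pos[of "\<alpha> + 1" k] \<alpha> by simp
  obtain e where e: "degree e = k" "lead_coeff e = 1" "\<And>q. degree q < k \<Longrightarrow> J (e * q) = 0"
    using ex_orthogonal[of k] by blast
  have e1: "poly e 1 \<noteq> 0" using e by (intro orthogonal_at_1[of e k]) auto
  show ?thesis
  proof (rule ex1I)
    show "is_jacobi_poly \<alpha> \<beta> k (Polynomial.smult (c / poly e 1) e)"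
      using e e1 c by (simp add: is_jacobi_poly_J c_def J_smult)
  next
    fix p assume "is_jacobi_poly \<alpha> \<beta> k p"
    then have p: "degree p = k" "\<And>q. degree q < k \<Longrightarrow> J (p * q) = 0" "poly p 1 = c"
      by (auto simp: is_jacobi_poly_J c_def)
    define d where "d = p - Polynomial.smult (lead_coeff p) e"
    have od: "J (d * q) = 0" if "degree q < k" for q
      using p(2)[OF that] e(3)[OF that] by (simp add: d_def left_diff_distrib J_diff J_smult)
    have "d = 0"
    proof (rule ccontr)
      assume d: "d \<noteq> 0"
      have "degree d \<le> k" unfolding d_def using p e by (intro degree_diff_le) auto
      moreover have "coeff d k = 0" using p e by (simp add: d_def)
      then have "degree d \<noteq> k" using d by (metis leading_coeff_0_iff)
      ultimately have "J (d * d) = 0" by (intro od) auto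
      moreover have "J (d * d) > 0" using d by (intro J_pos) auto
      ultimately show False by simp
    qed
    then have pe: "p = Polynomial.smult (lead_coeff p) e" by (simp add: d_def)
    have "c = lead_coeff p * poly e 1" using p(3) arg_cong[OF pe, of "\<lambda>p. poly p 1"] by simp
    then show "p = Polynomial.smult (c / poly e 1) e" using pe e1 by simp
  qed
qed

lemma is_jacobi_poly_jacobi_poly: "is_jacobi_poly \<alpha> \<beta> k (jacobi_poly \<alpha> \<beta> k)"
  unfolding jacobi_poly_def by (rule theI', rule ex1_jacobi_poly)

end

end

theory Submission
  imports Defs
begin

text \<open>
  The cells shrink to the Chebyshev nodes \<open>cos (\<tau> i)\<close> as \<open>\<rho>\<close> tends to \<open>0\<close>, and both directions
  rest on the equal-weight mean over these nodes.  That mean annihilates the Chebyshev polynomials \<open>T m\<close> with \<open>0 < m < 2 * N\<close> (lemma \<open>sum_cos_cell_angle\<close>).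

  Suppose \<open>\<alpha> = \<beta> = - 1 / 2\<close>.  Then the Jacobi polynomials are multiples of the \<open>T k\<close>.  The
  substitution \<open>x = cos t\<close> turns the weight into \<open>dt\<close> and a cell into an interval of length
  \<open>2 * \<rho>\<close> around \<open>\<tau> i\<close>, so the mean of \<open>T k\<close> over the cell is \<open>cos (k * \<tau> i)\<close> times a factor
  that depends on \<open>k\<close> and \<open>\<rho>\<close> but not on \<open>i\<close>.  The columns of the matrix are thus multiples of
  the vectors \<open>(cos (k * \<tau> i))\<^sub>i\<close>, which are pairwise orthogonal, whatever \<open>\<rho>\<close> is.

  Conversely, let all Gram matrices be diagonal.  Column \<open>0\<close> of the matrix is constantly \<open>1\<close>, so
  the entries \<open>(0, k)\<close> of the Gram matrix with \<open>0 < k < N\<close> say that column \<open>k\<close> sums to zero.  In the limit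
  \<open>\<rho> \<rightarrow> 0\<close> the sum of \<open>P k\<close> over the nodes vanishes (\<open>sum_jacobi_poly_nodes_eq_0\<close>), while the
  integral of \<open>P k\<close> against the Jacobi weight vanishes by definition.  As \<open>N \<ge> 3\<close>,
  this covers \<open>k = 1\<close> and \<open>k = 2\<close>.  Since \<open>P 1\<close> and \<open>P 2\<close>
  lie in the kernel of both functionals and span the quadratic polynomials together with \<open>1\<close>,
  the functionals are proportional in degrees up to \<open>2\<close>.  So the weighted means of \<open>x\<close> and
  \<open>x\<^sup>2\<close> are those over the nodes, namely \<open>0\<close> and \<open>1 / 2\<close>.  The moments of the Jacobi
  weight are explicit: the first equation gives \<open>\<alpha> = \<beta>\<close>, and then the second one gives
  \<open>1 / (2 * \<alpha> + 3) = 1 / 2\<close>.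
\<close>

section \<open>Sums over the Chebyshev nodes\<close>

text \<open>Multiplied by \<open>2 * sin (m * pi / (2 * N))\<close>, the sum telescopes to \<open>sin (m * pi) = 0\<close>.
  The bound on \<open>m\<close> keeps this factor away from zero.\<close>

lemma sum_cos_cell_angle:
  assumes "0 < m" "m < 2 * N"
  shows "(\<Sum>r<N. cos (real m * cell_angle N (Suc r))) = 0"
proof -
  define h where "h = real m * pi / (2 * real N)"
  have N: "real N > 0" using assms by simp
  have "h > 0" "h < pi" using assms N by (auto simp: h_def field_simps)
  then have s: "sin h > 0" by (rule sin_gt_zero)
  have tele: "2 * sin h * cos (real m * cell_angle N (Suc r))
      = sin (2 * h * real (Suc r)) - sin (2 * h * real r)" for r
  proof -
    have m: "real m * cell_angle N (Suc r) = 2 * h * real r + h"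
      using N by (simp add: cell_angle_def h_def field_simps)
    have "2 * h * real (Suc r) = (2 * h * real r + h) + h"
         "2 * h * real r = (2 * h * real r + h) - h"
      by (auto simp: algebra_simps)
    then have "sin (2 * h * real (Suc r)) - sin (2 * h * real r)
      = sin ((2 * h * real r + h) + h) - sin ((2 * h * real r + h) - h)"
      by simp
    then show ?thesis unfolding m sin_add sin_diff by simp
  qed
  have "2 * sin h * (\<Sum>r<N. cos (real m * cell_angle N (Suc r)))
      = (\<Sum>r<N. sin (2 * h * real (Suc r)) - sin (2 * h * real r))"
    by (simp only: sum_distrib_left tele)
  also have "\<dots> = sin (2 * h * real N)"
    by (subst sum_lessThan_telescope) simp
  also have "2 * h * real N = real m * pi" using N by (simp add: h_def)
  also have "sin (real m * pi) = 0" by simp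
  finally show ?thesis using s by simp
qed

lemma sum_cos_cos_cell_angle:
  assumes "j < N" "k < N" "j \<noteq> k"
  shows "(\<Sum>r<N. cos (real j * cell_angle N (Suc r)) * cos (real k * cell_angle N (Suc r))) = 0"
  using assms
proof (induction j k rule: linorder_wlog)
  case (le j k)
  have "cos (real j * t) * cos (real k * t)
      = (cos (real (k - j) * t) + cos (real (k + j) * t)) / 2" for t
    using le by (simp add: cos_times_cos of_nat_diff algebra_simps)
                (metis cos_minus minus_diff_eq)
  then have "(\<Sum>r<N. cos (real j * cell_angle N (Suc r)) * cos (real k * cell_angle N (Suc r)))
    = ((\<Sum>r<N. cos (real (k - j) * cell_angle N (Suc r)))
       + (\<Sum>r<N. cos (real (k + j) * cell_angle N (Suc r)))) / 2"
    by (simp only: sum.distrib sum_divide_distrib[symmetric])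
  also have "\<dots> = 0"
    using le sum_cos_cell_angle[of "k - j" N] sum_cos_cell_angle[of "k + j" N] by simp
  finally show ?case .
next
  case (sym j k)
  then show ?case by (simp add: mult.commute)
qed

lemma sum_nodes:
  assumes "N \<ge> 2"
  shows "(\<Sum>r<N. cos (cell_angle N (Suc r))) = 0"
    and "(\<Sum>r<N. (cos (cell_angle N (Suc r)))\<^sup>2) = real N / 2"
proof -
  show "(\<Sum>r<N. cos (cell_angle N (Suc r))) = 0"
    using sum_cos_cell_angle[of 1 N] assms by simp
  have "(\<Sum>r<N. (cos (cell_angle N (Suc r)))\<^sup>2)
      = (\<Sum>r<N. 1 / 2 + cos (real 2 * cell_angle N (Suc r)) / 2)"
    by (intro sum.cong refl) (simp add: cos_double_cos field_simps)
  also have "\<dots> = real N / 2 + (\<Sum>r<N. cos (real 2 * cell_angle N (Suc r))) / 2"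
    by (simp add: sum.distrib sum_divide_distrib)
  also have "\<dots> = real N / 2"
    using sum_cos_cell_angle[of 2 N] assms by simp
  finally show "(\<Sum>r<N. (cos (cell_angle N (Suc r)))\<^sup>2) = real N / 2" .
qed

section \<open>Cells and averages over them\<close>

lemma cell_angle_bounds:
  assumes "i \<in> {1..N}" "0 < \<rho>" "\<rho> < pi / (2 * real N)"
  shows "0 < cell_angle N i - \<rho>" "cell_angle N i + \<rho> < pi"
proof -
  have N: "real N > 0" and i: "1 \<le> real i" "real i \<le> real N" using assms by auto
  have c: "cell_angle N i = (2 * real i - 1) * (pi / (2 * real N))"
    by (simp add: cell_angle_def)
  have p: "pi / (2 * real N) > 0" using N by simp
  have "1 * (pi / (2 * real N)) \<le> cell_angle N i"
    unfolding c using p i by (intro mult_right_mono) auto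
  then show "0 < cell_angle N i - \<rho>" using assms by simp
  have "cell_angle N i \<le> (2 * real N - 1) * (pi / (2 * real N))"
    unfolding c using p i by (intro mult_right_mono) auto
  also have "\<dots> = pi - pi / (2 * real N)" using N by (simp add: field_simps)
  finally show "cell_angle N i + \<rho> < pi" using assms by simp
qed

lemma cell_subset:
  assumes "i \<in> {1..N}" "0 < \<rho>" "\<rho> < pi / (2 * real N)"
  shows "cell N \<rho> i \<subseteq> {-1<..<1}"
    and "cos (cell_angle N i + \<rho>) < cos (cell_angle N i - \<rho>)"
proof -
  note b = cell_angle_bounds[OF assms]
  have "cos (cell_angle N i - \<rho>) < cos 0"
    using b assms by (intro cos_monotone_0_pi) auto
  moreover have "cos pi < cos (cell_angle N i + \<rho>)"
    using b assms by (intro cos_monotone_0_pi) auto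
  ultimately show "cell N \<rho> i \<subseteq> {-1<..<1}" by (auto simp: cell_def)
  show "cos (cell_angle N i + \<rho>) < cos (cell_angle N i - \<rho>)"
    using b assms by (intro cos_monotone_0_pi) auto
qed

lemma arccos_cell:
  assumes "i \<in> {1..N}" "0 < \<rho>" "\<rho> < pi / (2 * real N)" "x \<in> cell N \<rho> i"
  shows "\<bar>arccos x - cell_angle N i\<bar> \<le> \<rho>"
proof -
  note b = cell_angle_bounds[OF assms(1-3)]
  have x: "-1 \<le> x" "x \<le> 1" using cell_subset(1)[OF assms(1-3)] assms(4) by auto
  have "arccos x \<le> arccos (cos (cell_angle N i + \<rho>))"
    using x assms(4) by (intro arccos_le_arccos) (auto simp: cell_def)
  moreover have "arccos (cos (cell_angle N i - \<rho>)) \<le> arccos x"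
    using x assms(4) by (intro arccos_le_arccos) (auto simp: cell_def)
  ultimately show ?thesis
    using b assms(2) by (simp add: arccos_cos)
qed

lemma continuous_on_jacobi_weight:
  assumes "S \<subseteq> {-1<..<1}"
  shows "continuous_on S (jacobi_weight \<alpha> \<beta>)"
  unfolding jacobi_weight_def using assms by (intro continuous_intros) auto

lemma integrable_on_cell:
  assumes "i \<in> {1..N}" "0 < \<rho>" "\<rho> < pi / (2 * real N)"
  shows "(\<lambda>x. poly p x * jacobi_weight \<alpha> \<beta> x) integrable_on cell N \<rho> i"
proof -
  have "continuous_on (cell N \<rho> i) (\<lambda>x. poly p x * jacobi_weight \<alpha> \<beta> x)"
    by (intro continuous_intros continuous_on_jacobi_weight cell_subset(1) assms)
  then show ?thesis unfolding cell_def by (rule integrable_continuous_real)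
qed

lemma cell_mass_pos:
  assumes "i \<in> {1..N}" "0 < \<rho>" "\<rho> < pi / (2 * real N)"
  shows "cell_mass \<alpha> \<beta> N \<rho> i > 0"
proof -
  note sub = cell_subset(1)[OF assms]
  let ?a = "cos (cell_angle N i + \<rho>)" and ?b = "cos (cell_angle N i - \<rho>)"
  have ab: "?a < ?b" by (rule cell_subset(2)[OF assms])
  have c: "continuous_on {?a..?b} (jacobi_weight \<alpha> \<beta>)"
    using continuous_on_jacobi_weight[OF sub] by (simp add: cell_def)
  have nn: "jacobi_weight \<alpha> \<beta> x \<ge> 0" for x by (simp add: jacobi_weight_def)
  have "?a \<in> cell N \<rho> i" using ab by (simp add: cell_def)
  then have "?a \<in> {-1<..<1}" using sub by blast
  then have "jacobi_weight \<alpha> \<beta> ?a > 0" by (simp add: jacobi_weight_def)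
  then have "integral {?a..?b} (jacobi_weight \<alpha> \<beta>) \<noteq> 0"
    using integral_eq_0_iff[OF c ab nn] ab by force
  moreover have "integral {?a..?b} (jacobi_weight \<alpha> \<beta>) \<ge> 0"
    using nn by (intro integral_nonneg integrable_continuous_real[OF c])
  ultimately show ?thesis by (simp add: cell_mass_def cell_def)
qed

text \<open>In the angle \<open>t = arccos x\<close> the cell is the ball of radius \<open>\<rho>\<close> around \<open>\<tau> i\<close>.  Continuity
  of \<open>p (cos t)\<close> thus makes \<open>p\<close> almost constant on a small cell, and a weighted average
  cannot leave the range of the averaged function.\<close>

lemma cell_average_tendsto:
  assumes i: "i \<in> {1..N}"
  shows "((\<lambda>\<rho>. 1 / cell_mass \<alpha> \<beta> N \<rho> i *
            integral (cell N \<rho> i) (\<lambda>x. poly p x * jacobi_weight \<alpha> \<beta> x))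
          \<longlongrightarrow> poly p (cos (cell_angle N i))) (at_right 0)"
proof (rule tendstoI)
  fix e :: real assume e: "e > 0"
  define v where "v = poly p (cos (cell_angle N i))"
  have "isCont (\<lambda>t. poly p (cos t)) (cell_angle N i)"
    by (intro continuous_intros)
  moreover have "e / 2 > 0" using e by simp
  ultimately obtain d where d: "d > 0"
    and close: "\<And>t. dist t (cell_angle N i) < d \<Longrightarrow> dist (poly p (cos t)) v < e / 2"
    unfolding continuous_at_eps_delta v_def by (metis dist_real_def)
  define D where "D = min d (pi / (2 * real N))"
  have D: "D > 0" using d i by (auto simp: D_def)
  have "dist (1 / cell_mass \<alpha> \<beta> N \<rho> i *
            integral (cell N \<rho> i) (\<lambda>x. poly p x * jacobi_weight \<alpha> \<beta> x)) v < e"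
    if \<rho>: "0 < \<rho>" "\<rho> < D" for \<rho>
  proof -
    have r: "\<rho> < pi / (2 * real N)" and rd: "\<rho> < d" using \<rho> by (auto simp: D_def)
    note cell = i \<rho>(1) r
    let ?m = "cell_mass \<alpha> \<beta> N \<rho> i"
    let ?I = "integral (cell N \<rho> i) (\<lambda>x. poly p x * jacobi_weight \<alpha> \<beta> x)"
    have m: "?m > 0" by (rule cell_mass_pos[OF cell])
    have const: "integral (cell N \<rho> i) (\<lambda>x. c * jacobi_weight \<alpha> \<beta> x) = c * ?m" for c
      by (simp add: cell_mass_def)
    have ci: "(\<lambda>x. c * jacobi_weight \<alpha> \<beta> x) integrable_on cell N \<rho> i" for c
      using integrable_on_cell[OF cell, of "[:c:]"] by simp
    have near: "v - e / 2 \<le> poly p x" "poly p x \<le> v + e / 2" if x: "x \<in> cell N \<rho> i" for x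
    proof -
      have x1: "-1 \<le> x" "x \<le> 1" using cell_subset(1)[OF cell] x by auto
      have "dist (poly p (cos (arccos x))) v < e / 2"
        using arccos_cell[OF cell x] rd by (intro close) (simp add: dist_real_def)
      then have "\<bar>poly p x - v\<bar> < e / 2"
        using x1 by (simp add: dist_real_def)
      then show "v - e / 2 \<le> poly p x" "poly p x \<le> v + e / 2"
        by linarith+
    qed
    have "(v - e / 2) * ?m \<le> ?I"
      unfolding const[symmetric] using near
      by (intro integral_le ci integrable_on_cell cell mult_right_mono)
         (auto simp: jacobi_weight_def)
    moreover have "?I \<le> (v + e / 2) * ?m"
      unfolding const[symmetric] using near
      by (intro integral_le ci integrable_on_cell cell mult_right_mono)
         (auto simp: jacobi_weight_def)
    ultimately have "v - e / 2 \<le> ?I / ?m" "?I / ?m \<le> v + e / 2"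
      using m by (auto simp: field_simps)
    then show ?thesis using e by (simp add: dist_real_def)
  qed
  then show "\<forall>\<^sub>F \<rho> in at_right 0. dist (1 / cell_mass \<alpha> \<beta> N \<rho> i *
      integral (cell N \<rho> i) (\<lambda>x. poly p x * jacobi_weight \<alpha> \<beta> x))
      (poly p (cos (cell_angle N i))) < e"
    unfolding v_def using D by (intro eventually_at_rightI[of 0 D]) auto
qed

section \<open>Entries of the Gram matrix\<close>

lemma histopolation_matrix_entry:
  assumes "r < N" "k < N"
  shows "histopolation_matrix \<alpha> \<beta> N \<rho> $$ (r, k) = 1 / cell_mass \<alpha> \<beta> N \<rho> (Suc r) *
     integral (cell N \<rho> (Suc r)) (\<lambda>x. poly (jacobi_poly \<alpha> \<beta> k) x * jacobi_weight \<alpha> \<beta> x)"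
  using assms by (simp add: histopolation_matrix_def)

lemma gram_entry:
  assumes "j < N" "k < N"
  shows "(transpose_mat (histopolation_matrix \<alpha> \<beta> N \<rho>) * histopolation_matrix \<alpha> \<beta> N \<rho>) $$ (j, k)
    = (\<Sum>r<N. histopolation_matrix \<alpha> \<beta> N \<rho> $$ (r, j) * histopolation_matrix \<alpha> \<beta> N \<rho> $$ (r, k))"
  using assms
  by (auto simp: histopolation_matrix_def scalar_prod_def atLeast0LessThan intro!: sum.cong)

lemma diagonal_gram_iff:
  "diagonal_mat (transpose_mat (histopolation_matrix \<alpha> \<beta> N \<rho>) * histopolation_matrix \<alpha> \<beta> N \<rho>)
   \<longleftrightarrow> (\<forall>j<N. \<forall>k<N. j \<noteq> k \<longrightarrow>
     (\<Sum>r<N. histopolation_matrix \<alpha> \<beta> N \<rho> $$ (r, j) * histopolation_matrix \<alpha> \<beta> N \<rho> $$ (r, k)) = 0)"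
proof -
  have d: "dim_row (histopolation_matrix \<alpha> \<beta> N \<rho>) = N" "dim_col (histopolation_matrix \<alpha> \<beta> N \<rho>) = N"
    by (simp_all add: histopolation_matrix_def)
  show ?thesis
    unfolding diagonal_mat_def by (simp add: d gram_entry del: index_mult_mat(1))
qed

section \<open>Diagonal Gram matrices force the Chebyshev weight\<close>

lemma jacobi_poly_0:
  assumes "\<alpha> > -1" "\<beta> > -1"
  shows "jacobi_poly \<alpha> \<beta> 0 = 1"
proof -
  have p: "degree (jacobi_poly \<alpha> \<beta> 0) = 0" "poly (jacobi_poly \<alpha> \<beta> 0) 1 = 1"
    using is_jacobi_poly_jacobi_poly[OF assms, of 0] by (auto simp: is_jacobi_poly_def)
  obtain c where "jacobi_poly \<alpha> \<beta> 0 = [:c:]" using p(1) by (rule degree_eq_zeroE)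
  then show ?thesis using p(2) by (simp add: one_pCons)
qed

lemma sum_jacobi_poly_nodes_eq_0:
  assumes ab: "\<alpha> > -1" "\<beta> > -1"
    and k: "0 < k" "k < N"
    and diag: "\<forall>\<rho>\<in>{0<..<pi / (2 * real N)}.
      diagonal_mat (transpose_mat (histopolation_matrix \<alpha> \<beta> N \<rho>) * histopolation_matrix \<alpha> \<beta> N \<rho>)"
  shows "(\<Sum>r<N. poly (jacobi_poly \<alpha> \<beta> k) (cos (cell_angle N (Suc r)))) = 0"
proof -
  let ?A = "\<lambda>\<rho> r. 1 / cell_mass \<alpha> \<beta> N \<rho> (Suc r) *
     integral (cell N \<rho> (Suc r)) (\<lambda>x. poly (jacobi_poly \<alpha> \<beta> k) x * jacobi_weight \<alpha> \<beta> x)"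
  have "((\<lambda>\<rho>. \<Sum>r<N. ?A \<rho> r) \<longlongrightarrow>
      (\<Sum>r<N. poly (jacobi_poly \<alpha> \<beta> k) (cos (cell_angle N (Suc r))))) (at_right 0)"
    by (intro tendsto_sum cell_average_tendsto) auto
  moreover have "(\<Sum>r<N. ?A \<rho> r) = 0" if \<rho>: "0 < \<rho>" "\<rho> < pi / (2 * real N)" for \<rho>
  proof -
    have one: "histopolation_matrix \<alpha> \<beta> N \<rho> $$ (r, 0) = 1" if r: "r < N" for r
      using cell_mass_pos[of "Suc r" N \<rho> \<alpha> \<beta>] \<rho> r k
      by (simp add: histopolation_matrix_entry jacobi_poly_0[OF ab] cell_mass_def)
    have "(\<Sum>r<N. histopolation_matrix \<alpha> \<beta> N \<rho> $$ (r, 0) * histopolation_matrix \<alpha> \<beta> N \<rho> $$ (r, k)) = 0"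
      using diag \<rho> k unfolding diagonal_gram_iff by auto
    moreover have "?A \<rho> r = histopolation_matrix \<alpha> \<beta> N \<rho> $$ (r, 0) *
        histopolation_matrix \<alpha> \<beta> N \<rho> $$ (r, k)" if "r < N" for r
      using that k by (simp only: one mult_1 histopolation_matrix_entry[of r N k])
    ultimately show ?thesis by (metis (no_types, lifting) lessThan_iff sum.cong)
  qed
  then have "\<forall>\<^sub>F \<rho> in at_right 0. (\<Sum>r<N. ?A \<rho> r) = 0"
    using k by (intro eventually_at_rightI[of 0 "pi / (2 * real N)"]) auto
  ultimately have "((\<lambda>\<rho>. 0) \<longlongrightarrow>
      (\<Sum>r<N. poly (jacobi_poly \<alpha> \<beta> k) (cos (cell_angle N (Suc r))))) (at_right (0::real))"
    using tendsto_cong by fast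
  then show ?thesis by (simp add: tendsto_const_iff)
qed

text \<open>Integrate the derivative of \<open>q * (1 - x) powr (\<alpha> + 1) * (1 + x) powr (\<beta> + 1)\<close>, which
  vanishes at both end points because the exponents are positive.\<close>

lemma jacobi_weight_by_parts:
  assumes ab: "\<alpha> > -1" "\<beta> > -1"
  shows "integral {-1<..<1} (\<lambda>x. poly (pderiv q * [:1, 0, -1:] +
     q * [:\<beta> - \<alpha>, - (\<alpha> + \<beta> + 2):]) x * jacobi_weight \<alpha> \<beta> x) = 0"
proof -
  define F where "F x = poly q x * ((1 - x) powr (\<alpha> + 1) * (1 + x) powr (\<beta> + 1))" for x :: real
  let ?g = "\<lambda>x. poly (pderiv q * [:1, 0, -1:] + q * [:\<beta> - \<alpha>, - (\<alpha> + \<beta> + 2):]) x * jacobi_weight \<alpha> \<beta> x"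
  have "(?g has_integral (F 1 - F (-1))) {-1..1}"
  proof (rule fundamental_theorem_of_calculus_interior)
    show "continuous_on {-1..1} F"
      unfolding F_def using ab by (intro continuous_intros continuous_on_powr') auto
  next
    fix x :: real assume x: "x \<in> {-1<..<1}"
    have p: "(1 - x) powr (\<alpha> + 1) = (1 - x) * (1 - x) powr \<alpha>"
            "(1 + x) powr (\<beta> + 1) = (1 + x) * (1 + x) powr \<beta>"
      using x by (simp_all add: powr_add)
    have "(F has_real_derivative
        poly (pderiv q) x * ((1 - x) powr (\<alpha> + 1) * (1 + x) powr (\<beta> + 1)) +
        poly q x * (- ((\<alpha> + 1) * (1 - x) powr \<alpha>) * (1 + x) powr (\<beta> + 1) +
          (1 - x) powr (\<alpha> + 1) * ((\<beta> + 1) * (1 + x) powr \<beta>))) (at x)"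
      unfolding F_def using x
      by (auto intro!: derivative_eq_intros simp: algebra_simps)
    moreover have "poly (pderiv q) x * ((1 - x) powr (\<alpha> + 1) * (1 + x) powr (\<beta> + 1)) +
        poly q x * (- ((\<alpha> + 1) * (1 - x) powr \<alpha>) * (1 + x) powr (\<beta> + 1) +
          (1 - x) powr (\<alpha> + 1) * ((\<beta> + 1) * (1 + x) powr \<beta>)) = ?g x"
      unfolding p jacobi_weight_def by (simp add: algebra_simps)
    ultimately show "(F has_vector_derivative ?g x) (at x)"
      by (simp add: has_real_derivative_iff_has_vector_derivative)
  qed simp
  moreover have "F 1 = 0" "F (-1) = 0" by (simp_all add: F_def)
  ultimately have "(?g has_integral 0) {-1<..<1}"
    by (simp add: has_integral_Icc_iff_Ioo)
  then show ?thesis by (rule integral_unique)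
qed

text \<open>The first two columns that sum to zero determine the moments of order \<open>1\<close> and \<open>2\<close>
  relative to the total mass, and the moment relations from \<open>jacobi_weight_by_parts\<close> with
  \<open>q = 1\<close> and \<open>q = x\<close> turn these into equations for the exponents.\<close>

lemma diagonal_imp_chebyshev:
  assumes ab: "\<alpha> > -1" "\<beta> > -1" and N: "N \<ge> 3"
    and diag: "\<forall>\<rho>\<in>{0<..<pi / (2 * real N)}.
      diagonal_mat (transpose_mat (histopolation_matrix \<alpha> \<beta> N \<rho>) * histopolation_matrix \<alpha> \<beta> N \<rho>)"
  shows "\<alpha> = - 1 / 2 \<and> \<beta> = - 1 / 2"
proof -
  define M where "M n = integral {-1<..<1} (\<lambda>x. poly (monom 1 n) x * jacobi_weight \<alpha> \<beta> x)" for n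
  have int: "(\<lambda>x. c * (x ^ n * jacobi_weight \<alpha> \<beta> x)) integrable_on {-1<..<1}" for c n
    using poly_jacobi_weight_integrable[OF ab, of "monom c n"]
    by (simp add: poly_monom mult.assoc)
  have quad: "integral {-1<..<1} (\<lambda>x. poly [:a, b, c:] x * jacobi_weight \<alpha> \<beta> x)
      = a * M 0 + b * M 1 + c * M 2" for a b c
  proof -
    have "poly [:a, b, c:] x * jacobi_weight \<alpha> \<beta> x = a * (x ^ 0 * jacobi_weight \<alpha> \<beta> x)
       + b * (x ^ 1 * jacobi_weight \<alpha> \<beta> x) + c * (x ^ 2 * jacobi_weight \<alpha> \<beta> x)" for x
      by (simp add: algebra_simps power2_eq_square)
    then show ?thesis
      by (simp only: integral_add integrable_add int integral_mult_right M_def poly_monom mult_1)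
  qed
  have M0: "M 0 > 0"
  proof -
    define \<rho> where "\<rho> = pi / (4 * real N)"
    have \<rho>: "0 < \<rho>" "\<rho> < pi / (2 * real N)" and i: "1 \<in> {1..N}"
      using N by (auto simp: \<rho>_def field_simps)
    have "0 < integral (cell N \<rho> 1) (jacobi_weight \<alpha> \<beta>)"
      using cell_mass_pos[OF i \<rho>] by (simp add: cell_mass_def)
    also have "\<dots> \<le> integral {-1<..<1} (jacobi_weight \<alpha> \<beta>)"
    proof (rule integral_subset_le)
      show "cell N \<rho> 1 \<subseteq> {-1<..<1}" by (rule cell_subset(1)[OF i \<rho>])
      show "jacobi_weight \<alpha> \<beta> integrable_on cell N \<rho> 1"
        using integrable_on_cell[OF i \<rho>, of 1] by simp
      show "jacobi_weight \<alpha> \<beta> integrable_on {-1<..<1}"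
        using poly_jacobi_weight_integrable[OF ab, of 1] by simp
    qed (simp add: jacobi_weight_def)
    also have "\<dots> = M 0" by (simp add: M_def poly_monom)
    finally show ?thesis .
  qed
  have orth: "integral {-1<..<1} (\<lambda>x. poly (jacobi_poly \<alpha> \<beta> k) x * jacobi_weight \<alpha> \<beta> x) = 0"
    if "0 < k" for k
  proof -
    have "degree (1 :: real poly) < k" using that by simp
    then have "integral {-1<..<1} (\<lambda>x. poly (jacobi_poly \<alpha> \<beta> k) x * poly 1 x * jacobi_weight \<alpha> \<beta> x) = 0"
      using is_jacobi_poly_jacobi_poly[OF ab, of k] unfolding is_jacobi_poly_def by blast
    then show ?thesis by simp
  qed
  have deg: "degree (jacobi_poly \<alpha> \<beta> k) = k" for k
    using is_jacobi_poly_jacobi_poly[OF ab, of k] by (simp add: is_jacobi_poly_def)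
  have nodes: "(\<Sum>r<N. poly [:a, b, c:] (cos (cell_angle N (Suc r)))) = real N * (a + c / 2)" for a b c
  proof -
    have "(\<Sum>r<N. poly [:a, b, c:] (cos (cell_angle N (Suc r))))
        = (\<Sum>r<N. a + b * cos (cell_angle N (Suc r)) + c * (cos (cell_angle N (Suc r)))\<^sup>2)"
      by (simp add: algebra_simps power2_eq_square)
    also have "\<dots> = real N * a + b * (\<Sum>r<N. cos (cell_angle N (Suc r)))
        + c * (\<Sum>r<N. (cos (cell_angle N (Suc r)))\<^sup>2)"
      by (simp add: sum.distrib sum_distrib_left)
    also have "\<dots> = real N * (a + c / 2)"
      using N by (simp add: sum_nodes algebra_simps)
    finally show ?thesis .
  qed
  have M1: "M 1 = 0"
  proof -
    obtain a b where p: "jacobi_poly \<alpha> \<beta> 1 = [:a, b:]" and b: "b \<noteq> 0"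
      using degree1_coeffs[OF deg[of 1]] by blast
    have "a = 0"
      using sum_jacobi_poly_nodes_eq_0[OF ab _ _ diag, of 1] N nodes[of a b 0] p by simp
    then show ?thesis using orth[of 1] quad[of a b 0] p b by simp
  qed
  have M2: "M 2 = M 0 / 2"
  proof -
    obtain a b c where p: "jacobi_poly \<alpha> \<beta> 2 = [:a, b, c:]" and c: "c \<noteq> 0"
      using degree2_coeffs[OF deg[of 2]] by blast
    have "a = - c / 2"
      using sum_jacobi_poly_nodes_eq_0[OF ab _ _ diag, of 2] N nodes[of a b c] p by simp
    then have "c * (M 2 - M 0 / 2) = 0"
      using orth[of 2] unfolding p quad M1 by (simp add: algebra_simps)
    then show ?thesis using c by simp
  qed
  have pol: "pderiv 1 * [:1, 0, -1:] + 1 * [:\<beta> - \<alpha>, - (\<alpha> + \<beta> + 2):]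
      = [:\<beta> - \<alpha>, - (\<alpha> + \<beta> + 2), 0:]"
    by (simp add: pderiv_1)
  have "(\<beta> - \<alpha>) * M 0 = 0"
    using jacobi_weight_by_parts[OF ab, of 1] unfolding pol quad M1 by simp
  then have eq: "\<beta> = \<alpha>" using M0 by simp
  have pol: "pderiv [:0, 1:] * [:1, 0, -1:] + [:0, 1:] * [:\<beta> - \<alpha>, - (\<alpha> + \<beta> + 2):]
      = [:1, 0, - (2 * \<alpha> + 3):]"
    by (simp add: eq pderiv_pCons)
  have "M 0 - (2 * \<alpha> + 3) * M 2 = 0"
    using jacobi_weight_by_parts[OF ab, of "[:0, 1:]"] unfolding pol quad by linarith
  then have "(2 * \<alpha> + 1) * M 0 = 0" unfolding M2 by (simp add: algebra_simps)
  then have "2 * \<alpha> + 1 = 0" using M0 by simp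
  then have "\<alpha> = - 1 / 2" by linarith
  then show ?thesis using eq by simp
qed

section \<open>Chebyshev polynomials as Jacobi polynomials\<close>

fun cheb :: "nat \<Rightarrow> real poly" where
  "cheb 0 = 1"
| "cheb (Suc 0) = [:0, 1:]"
| "cheb (Suc (Suc k)) = [:0, 2:] * cheb (Suc k) - cheb k"

lemma poly_cheb_cos: "poly (cheb k) (cos t) = cos (real k * t)"
proof (induction k rule: cheb.induct)
  case (3 k)
  have "cos (real (Suc (Suc k)) * t) = cos (real (Suc k) * t + t)"
       "cos (real k * t) = cos (real (Suc k) * t - t)"
    by (simp_all add: algebra_simps)
  then show ?case
    using 3 by (simp only: cheb.simps poly_diff poly_mult cos_add cos_diff) simp
qed auto

lemma degree_cheb: "degree (cheb k) = k"
proof -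
  \<comment> \<open>Positivity of the top coefficient is what survives the recursion and keeps it from vanishing.\<close>
  have "degree (cheb k) \<le> k \<and> coeff (cheb k) k > 0" for k
  proof (induction k rule: cheb.induct)
    case (3 k)
    have "degree ([:0, 2:] * cheb (Suc k)) \<le> Suc (Suc k)"
      using degree_mult_le[of "[:0, 2 :: real:]" "cheb (Suc k)"] 3 by auto
    moreover have "degree (cheb k) < Suc (Suc k)" using 3 by auto
    ultimately have "degree (cheb (Suc (Suc k))) \<le> Suc (Suc k)"
      unfolding cheb.simps by (intro degree_diff_le) auto
    moreover have "coeff (cheb (Suc (Suc k))) (Suc (Suc k)) = 2 * coeff (cheb (Suc k)) (Suc k)"
      using 3 by (simp add: coeff_eq_0)
    ultimately show ?case using 3 by simp
  qed auto
  then show ?thesis by (metis antisym le_degree less_numeral_extra(3))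
qed

definition cheb_primitive :: "nat \<Rightarrow> real \<Rightarrow> real" where
  "cheb_primitive m x = (if m = 0 then - arccos x else - sin (real m * arccos x) / real m)"

text \<open>The substitution \<open>x = cos t\<close> in the form of a primitive: since the derivative of
  \<open>arccos\<close> is minus the weight, the fundamental theorem applies up to the singular end points
  \<open>-1\<close> and \<open>1\<close>, where the primitive is still continuous.\<close>

lemma cheb_weight_has_integral:
  assumes "-1 \<le> a" "a \<le> b" "b \<le> 1"
  shows "((\<lambda>x. poly (cheb m) x * jacobi_weight (-1/2) (-1/2) x) has_integral
    (cheb_primitive m b - cheb_primitive m a)) {a..b}"
proof (rule fundamental_theorem_of_calculus_interior)
  show "continuous_on {a..b} (cheb_primitive m)"
    unfolding cheb_primitive_def using assms by (cases "m = 0") (auto intro!: continuous_intros)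
next
  fix x :: real assume "x \<in> {a<..<b}"
  then have x: "-1 < x" "x < 1" using assms by auto
  have w: "jacobi_weight (-1/2) (-1/2) x = 1 / sqrt (1 - x\<^sup>2)"
  proof -
    have "1 - x\<^sup>2 = (1 - x) * (1 + x)" by (simp add: power2_eq_square algebra_simps)
    then have "sqrt (1 - x\<^sup>2) = sqrt (1 - x) * sqrt (1 + x)" by (simp add: real_sqrt_mult)
    moreover have "y powr (-1/2) = 1 / sqrt y" if "y > 0" for y :: real
      using that powr_minus[of y "1/2"] by (simp add: powr_half_sqrt inverse_eq_divide)
    ultimately show ?thesis
      using x unfolding jacobi_weight_def by simp
  qed
  have c: "poly (cheb m) x = cos (real m * arccos x)"
    using poly_cheb_cos[of m "arccos x"] x by simp
  have "(cheb_primitive m has_real_derivative poly (cheb m) x * jacobi_weight (-1/2) (-1/2) x) (at x)"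
  proof (cases "m = 0")
    case True
    then have "cheb_primitive m = (\<lambda>x. - arccos x)" by (auto simp: cheb_primitive_def)
    then show ?thesis
      unfolding w c using True x by (auto intro!: derivative_eq_intros simp: field_simps)
  next
    case False
    then have "cheb_primitive m = (\<lambda>x. - sin (real m * arccos x) / real m)"
      by (auto simp: cheb_primitive_def)
    then show ?thesis
      unfolding w c using False x by (auto intro!: derivative_eq_intros simp: field_simps)
  qed
  then show "(cheb_primitive m has_vector_derivative
      poly (cheb m) x * jacobi_weight (-1/2) (-1/2) x) (at x)"
    by (simp add: has_real_derivative_iff_has_vector_derivative)
qed (use assms in auto)

text \<open>Induction on \<open>j\<close> with \<open>x * T k = (T (k + 1) + T (k - 1)) / 2\<close>: each step lowers the power
  of \<open>x\<close> by one and the index by at most one, so the index stays above the power.\<close>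

lemma cheb_orthogonal_monom:
  assumes "j < k"
  shows "integral {-1<..<1} (\<lambda>x. x ^ j * (poly (cheb k) x * jacobi_weight (-1/2) (-1/2) x)) = 0"
  using assms
proof (induction j arbitrary: k)
  case 0
  have "((\<lambda>x. poly (cheb k) x * jacobi_weight (-1/2) (-1/2) x) has_integral
      (cheb_primitive k 1 - cheb_primitive k (-1))) {-1..1}"
    by (rule cheb_weight_has_integral) auto
  moreover have "cheb_primitive k 1 = 0" "cheb_primitive k (-1) = 0"
    using 0 by (simp_all add: cheb_primitive_def)
  ultimately have "((\<lambda>x. poly (cheb k) x * jacobi_weight (-1/2) (-1/2) x) has_integral 0) {-1<..<1}"
    by (simp add: has_integral_Icc_iff_Ioo)
  then show ?case by (simp add: integral_unique)
next
  case (Suc j)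
  then obtain n where k: "k = Suc n" and n: "j < n" by (cases k) auto
  let ?f = "\<lambda>m x. x ^ j * (poly (cheb m) x * jacobi_weight (-1/2) (-1/2) x)"
  have int: "?f m integrable_on {-1<..<1}" for m
    using poly_jacobi_weight_integrable[of "-1/2" "-1/2" "monom 1 j * cheb m"]
    by (simp add: poly_monom mult.assoc)
  have "x ^ Suc j * (poly (cheb k) x * jacobi_weight (-1/2) (-1/2) x)
      = 1 / 2 * (?f (Suc k) x + ?f n x)" for x
    unfolding k by (simp add: algebra_simps)
  then have "integral {-1<..<1} (\<lambda>x. x ^ Suc j * (poly (cheb k) x * jacobi_weight (-1/2) (-1/2) x))
      = 1 / 2 * (integral {-1<..<1} (?f (Suc k)) + integral {-1<..<1} (?f n))"
    by (simp only: integral_mult_right integral_add int)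
  then show ?case using Suc.IH[of "Suc k"] Suc.IH[of n] Suc.prems n by simp
qed

lemma cheb_orthogonal:
  assumes "degree q < k"
  shows "integral {-1<..<1} (\<lambda>x. poly (cheb k) x * poly q x * jacobi_weight (-1/2) (-1/2) x) = 0"
proof -
  let ?f = "\<lambda>j x. x ^ j * (poly (cheb k) x * jacobi_weight (-1/2) (-1/2) x)"
  have int: "?f j integrable_on {-1<..<1}" for j
    using poly_jacobi_weight_integrable[of "-1/2" "-1/2" "monom 1 j * cheb k"]
    by (simp add: poly_monom mult.assoc)
  have "poly (cheb k) x * poly q x * jacobi_weight (-1/2) (-1/2) x
      = (\<Sum>j\<le>degree q. coeff q j * ?f j x)" for x
  proof -
    have "poly (cheb k) x * poly q x * jacobi_weight (-1/2) (-1/2) x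
        = poly q x * (poly (cheb k) x * jacobi_weight (-1/2) (-1/2) x)"
      by (simp only: mult_ac)
    then show ?thesis by (simp only: poly_altdef[of q] sum_distrib_right mult.assoc)
  qed
  then have "integral {-1<..<1} (\<lambda>x. poly (cheb k) x * poly q x * jacobi_weight (-1/2) (-1/2) x)
      = (\<Sum>j\<le>degree q. integral {-1<..<1} (\<lambda>x. coeff q j * ?f j x))"
    by (simp only: integral_sum integrable_on_mult_right int finite_atMost)
  also have "\<dots> = 0"
  proof (intro sum.neutral ballI)
    fix j assume "j \<in> {..degree q}"
    then have "integral {-1<..<1} (?f j) = 0"
      using assms by (intro cheb_orthogonal_monom) simp
    then show "integral {-1<..<1} (\<lambda>x. coeff q j * ?f j x) = 0"
      by (simp only: integral_mult_right mult_zero_right)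
  qed
  finally show ?thesis .
qed

text \<open>Uniqueness of Jacobi polynomials reduces this to orthogonality and to the value at \<open>1\<close>,
  where \<open>T k\<close> is \<open>cos 0 = 1\<close>.\<close>

lemma jacobi_poly_chebyshev:
  "jacobi_poly (-1/2) (-1/2) k
     = Polynomial.smult (pochhammer (1/2) k / fact k) (cheb k)"
proof -
  have "poly (cheb k) 1 = 1" using poly_cheb_cos[of k 0] by simp
  moreover have "pochhammer (1/2 :: real) k > 0" by (rule pochhammer_pos) simp
  ultimately have "is_jacobi_poly (-1/2) (-1/2) k
      (Polynomial.smult (pochhammer (1/2) k / fact k) (cheb k))"
    using cheb_orthogonal[of _ k] by (auto simp: is_jacobi_poly_def degree_cheb mult.assoc)
  moreover have "is_jacobi_poly (-1/2) (-1/2) k (jacobi_poly (-1/2) (-1/2) k)"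
    by (rule is_jacobi_poly_jacobi_poly) auto
  ultimately show ?thesis using ex1_jacobi_poly[of "-1/2" "-1/2" k] by auto
qed

section \<open>The Chebyshev weight gives diagonal Gram matrices\<close>

text \<open>The cell number enters only through \<open>cos (m * \<tau> i)\<close>; the other factor is common to a whole
  column of the matrix.\<close>

lemma integral_cell_cheb:
  assumes "i \<in> {1..N}" "0 < \<rho>" "\<rho> < pi / (2 * real N)"
  shows "integral (cell N \<rho> i) (\<lambda>x. poly (cheb m) x * jacobi_weight (-1/2) (-1/2) x)
     = (if m = 0 then 2 * \<rho> else 2 * sin (real m * \<rho>) / real m) * cos (real m * cell_angle N i)"
proof -
  define t where "t = cell_angle N i"
  note b = cell_angle_bounds[OF assms, folded t_def]
  have "cos (t + \<rho>) \<le> cos (t - \<rho>)"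
    using cell_subset(2)[OF assms] by (simp add: t_def)
  then have "integral (cell N \<rho> i) (\<lambda>x. poly (cheb m) x * jacobi_weight (-1/2) (-1/2) x)
      = cheb_primitive m (cos (t - \<rho>)) - cheb_primitive m (cos (t + \<rho>))"
    unfolding cell_def t_def[symmetric]
    by (intro integral_unique cheb_weight_has_integral) auto
  moreover have "arccos (cos (t - \<rho>)) = t - \<rho>" "arccos (cos (t + \<rho>)) = t + \<rho>"
    using b assms(2) by (auto intro!: arccos_cos)
  ultimately have "integral (cell N \<rho> i) (\<lambda>x. poly (cheb m) x * jacobi_weight (-1/2) (-1/2) x)
      = (if m = 0 then 2 * \<rho> else (sin (real m * (t + \<rho>)) - sin (real m * (t - \<rho>))) / real m)"
    by (simp add: cheb_primitive_def diff_divide_distrib)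
  also have "sin (real m * (t + \<rho>)) - sin (real m * (t - \<rho>))
      = 2 * sin (real m * \<rho>) * cos (real m * t)"
    by (simp add: distrib_left right_diff_distrib sin_add sin_diff)
  finally show ?thesis
    by (simp add: t_def)
qed

lemma chebyshev_imp_diagonal:
  assumes \<rho>: "0 < \<rho>" "\<rho> < pi / (2 * real N)"
  shows "diagonal_mat (transpose_mat (histopolation_matrix (-1/2) (-1/2) N \<rho>)
    * histopolation_matrix (-1/2) (-1/2) N \<rho>)"
proof -
  define d where "d m = (if m = 0 then 2 * \<rho> else 2 * sin (real m * \<rho>) / real m)" for m :: nat
  define g where "g k = pochhammer (1/2) k / fact k * d k / (2 * \<rho>)" for k :: nat
  have entry: "histopolation_matrix (-1/2) (-1/2) N \<rho> $$ (r, k)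
      = g k * cos (real k * cell_angle N (Suc r))" if "r < N" "k < N" for r k
  proof -
    have i: "Suc r \<in> {1..N}" using that by auto
    have "cell_mass (-1/2) (-1/2) N \<rho> (Suc r) = 2 * \<rho>"
      using integral_cell_cheb[OF i \<rho>, of 0] by (simp add: cell_mass_def)
    moreover have "integral (cell N \<rho> (Suc r))
        (\<lambda>x. poly (jacobi_poly (-1/2) (-1/2) k) x * jacobi_weight (-1/2) (-1/2) x)
      = pochhammer (1/2) k / fact k * (d k * cos (real k * cell_angle N (Suc r)))"
      using integral_cell_cheb[OF i \<rho>, of k, folded d_def]
      by (simp only: jacobi_poly_chebyshev poly_smult mult.assoc integral_mult_right)
    ultimately show ?thesis
      using that by (simp only: histopolation_matrix_entry) (simp add: g_def mult_ac)
  qed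
  show ?thesis
    unfolding diagonal_gram_iff
  proof (intro allI impI)
    fix j k assume jk: "j < N" "k < N" "j \<noteq> k"
    have "(\<Sum>r<N. histopolation_matrix (-1/2) (-1/2) N \<rho> $$ (r, j) *
          histopolation_matrix (-1/2) (-1/2) N \<rho> $$ (r, k))
        = g j * g k * (\<Sum>r<N. cos (real j * cell_angle N (Suc r)) * cos (real k * cell_angle N (Suc r)))"
      unfolding sum_distrib_left using jk
      by (intro sum.cong refl) (simp only: entry lessThan_iff mult_ac)
    then show "(\<Sum>r<N. histopolation_matrix (-1/2) (-1/2) N \<rho> $$ (r, j) *
          histopolation_matrix (-1/2) (-1/2) N \<rho> $$ (r, k)) = 0"
      by (simp add: sum_cos_cos_cell_angle[OF jk])
  qed
qed

theorem theorem4: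
  fixes \<alpha> \<beta> :: real and N :: nat
  assumes "\<alpha> > -1" and "\<beta> > -1" and "N \<ge> 3"
  shows "(\<forall>\<rho>\<in>{0<..<pi / (2 * real N)}.
            diagonal_mat (transpose_mat (histopolation_matrix \<alpha> \<beta> N \<rho>) * histopolation_matrix \<alpha> \<beta> N \<rho>))
         \<longleftrightarrow> \<alpha> = - 1 / 2 \<and> \<beta> = - 1 / 2"
  using diagonal_imp_chebyshev[OF assms] chebyshev_imp_diagonal[of _ N] by auto

end
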